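(* For any $\beta>0$ and any $n\ge\log(1/\beta)$, there exists an algorithm $\mathcal{M}\colon\mathcal{X}^n\to\mathcal{R}$ (for some domain $\mathcal{X}$ and range $\mathcal{R}$) which is $(\beta,0,0)$-perfectly generalizing but is not $(\varepsilon,\delta)$-differentially private for any $\varepsilon<\infty$ and $\delta<1$.
   Context: $(\varepsilon,\delta)$-closeness of distributions $\mathcal{J}_1,\mathcal{J}_2$ over $\mathcal{R}$: for every $\mathcal{O}\subseteq\mathcal{R}$, $\Pr_{\mathcal{J}_1}[\mathcal{O}]\le e^{\varepsilon}\Pr_{\mathcal{J}_2}[\mathcal{O}]+\delta$ and vice versa. $\mathcal{M}\colon\mathcal{X}^n\to\mathcal{R}$ is $(\beta,\varepsilon,\delta)$-perfectly generalizing if for every distribution $\mathcal{C}$ over $\mathcal{X}$ there is a distribution $\mathrm{Sim}_{\mathcal{C}}$ over $\mathcal{R}$ such that with probability at least $1-\beta$ over $T\sim_{i.i.d.}\mathcal{C}^n$, $\mathcal{M}(T)$ and $\mathrm{Sim}_{\mathcal{C}}$ are $(\varepsilon,\delta)$-close. $\mathcal{M}$ is $(\varepsilon,\delta)$-differentially private if $\mathcal{M}(T),\mathcal{M}(T')$ are $(\varepsilon,\delta)$-close for all $T,T'\in\mathcal{X}^n$ differing in exactly one element. $\log$ is base 2. *)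

theory Defs
  imports "HOL-Probability.Probability" "HOL-Library.NList"
begin

text \<open>
  Data sets in \<open>X^n\<close> are the lists in \<^term>\<open>nlists n X\<close>, and a randomized algorithm maps each of
  them to the distribution of its output.  Domains and ranges are subsets of countable types, so
  that every distribution on them (with all subsets as events) is a \<open>pmf\<close> supported there.
\<close>

definition eps_delta_close ::
    "real \<Rightarrow> real \<Rightarrow> 'r::countable set \<Rightarrow> 'r pmf \<Rightarrow> 'r pmf \<Rightarrow> bool" where
  "eps_delta_close \<epsilon> \<delta> R J1 J2 \<longleftrightarrow>
     (\<forall>A. A \<subseteq> R \<longrightarrow>
        measure_pmf.prob J1 A \<le> exp \<epsilon> * measure_pmf.prob J2 A + \<delta> \<and>
        measure_pmf.prob J2 A \<le> exp \<epsilon> * measure_pmf.prob J1 A + \<delta>)"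

definition randomized_algorithm ::
    "nat \<Rightarrow> 'x::countable set \<Rightarrow> 'r::countable set \<Rightarrow> ('x list \<Rightarrow> 'r pmf) \<Rightarrow> bool" where
  "randomized_algorithm n X R M \<longleftrightarrow> (\<forall>T \<in> nlists n X. set_pmf (M T) \<subseteq> R)"

definition perfectly_generalizing ::
    "nat \<Rightarrow> 'x::countable set \<Rightarrow> 'r::countable set \<Rightarrow> real \<Rightarrow> real \<Rightarrow> real
      \<Rightarrow> ('x list \<Rightarrow> 'r pmf) \<Rightarrow> bool" where
  "perfectly_generalizing n X R \<beta> \<epsilon> \<delta> M \<longleftrightarrow>
     (\<forall>C. set_pmf C \<subseteq> X \<longrightarrow>
        (\<exists>Sim. set_pmf Sim \<subseteq> R \<and>
           measure_pmf.prob (replicate_pmf n C) {T. eps_delta_close \<epsilon> \<delta> R (M T) Sim} \<ge> 1 - \<beta>))"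

definition neighbouring :: "'x list \<Rightarrow> 'x list \<Rightarrow> bool" where
  "neighbouring T T' \<longleftrightarrow>
     length T = length T' \<and> card {i. i < length T \<and> T ! i \<noteq> T' ! i} = 1"

definition differentially_private ::
    "nat \<Rightarrow> 'x::countable set \<Rightarrow> 'r::countable set \<Rightarrow> real \<Rightarrow> real
      \<Rightarrow> ('x list \<Rightarrow> 'r pmf) \<Rightarrow> bool" where
  "differentially_private n X R \<epsilon> \<delta> M \<longleftrightarrow>
     (\<forall>T \<in> nlists n X. \<forall>T' \<in> nlists n X.
        neighbouring T T' \<longrightarrow> eps_delta_close \<epsilon> \<delta> R (M T) (M T'))"

end

theory Submission imports Defs begin

text \<open>
  The algorithm reports whether its input is the list \<open>s = [0, \<dots>, n - 1]\<close>.  Its output changes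
  with certainty between \<open>s\<close> and a neighbour, so it is not private.  By AM-GM the probability
  \<open>\<Prod>\<^sub>i C(i)\<close> of sampling \<open>s\<close> is at most \<open>n\<^sup>-\<^sup>n\<close>, which for \<open>n \<ge> 2\<close> is at most \<open>2\<^sup>-\<^sup>n \<le> \<beta>\<close>, so the
  constant output "no" simulates it.  For \<open>n = 1\<close>, where \<open>\<beta> \<ge> 1/2\<close>, the likelier of the two outputs
  is a simulator.
\<close>

lemma eps_delta_close_refl: "eps_delta_close 0 0 R J J"
  by (simp add: eps_delta_close_def)

lemma pmf_replicate_pmf: "pmf (replicate_pmf (length xs) p) xs = prod_list (map (pmf p) xs)"
proof (induction xs)
  case (Cons x xs)
  \<comment> \<open>Head and tail are drawn independently, and consing them is injective, so no
    probability mass is merged and the pair's mass carries over.\<close>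
  have "pmf (replicate_pmf (Suc (length xs)) p) (x # xs)
      = pmf (map_pmf (\<lambda>(y, ys). y # ys) (pair_pmf p (replicate_pmf (length xs) p)))
          ((\<lambda>(y, ys). y # ys) (x, xs))"
    by (simp add: pair_pmf_def map_bind_pmf map_pmf_def bind_assoc_pmf bind_return_pmf)
  also have "\<dots> = pmf (pair_pmf p (replicate_pmf (length xs) p)) (x, xs)"
    by (rule pmf_map_inj') (auto simp: inj_on_def)
  finally show ?case
    using Cons.IH by (simp add: pmf_pair)
qed simp

text \<open>Distinctness makes the factors masses of different points, so their sum is at most 1 and
  AM-GM bounds their product. With repetitions this fails: a point mass gives a constant list
  probability 1.\<close>

lemma pmf_replicate_pmf_distinct_le:
  assumes "distinct xs" and "xs \<noteq> []"
  shows "pmf (replicate_pmf (length xs) p) xs \<le> (1 / real (length xs)) ^ length xs"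
proof -
  let ?n = "length xs"
  have n: "card (set xs) = ?n" "?n > 0"
    using assms by (auto simp: distinct_card)
  have "(\<Sum>x\<in>set xs. pmf p x) \<le> 1"
    by (metis List.finite_set measure_measure_pmf_finite measure_pmf.prob_le_1)
  then have "(\<Sum>x\<in>set xs. pmf p x / ?n) \<le> 1 / ?n"
    by (simp add: divide_right_mono flip: sum_divide_distrib)
  moreover have "(\<Prod>x\<in>set xs. pmf p x) powr (1 / ?n) \<le> (\<Sum>x\<in>set xs. pmf p x / ?n)"
    using arith_geom_mean[of "set xs" "pmf p"] assms n by simp
  ultimately have "((\<Prod>x\<in>set xs. pmf p x) powr (1 / ?n)) ^ ?n \<le> (1 / ?n) ^ ?n"
    by (intro power_mono) auto
  \<comment> \<open>The product may be 0; the power still undoes the root because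
    \<open>?n > 0\<close>.\<close>
  also have "((\<Prod>x\<in>set xs. pmf p x) powr (1 / ?n)) ^ ?n = (\<Prod>x\<in>set xs. pmf p x)"
    using n by (simp add: powr_powr prod_nonneg flip: powr_realpow')
  finally show ?thesis
    using assms by (simp add: pmf_replicate_pmf prod.distinct_set_conv_list)
qed

theorem theorem5p3:
  fixes \<beta> :: real and n :: nat
  assumes "\<beta> > 0" and "n \<ge> 1" and "real n \<ge> log 2 (1 / \<beta>)"
  shows "\<exists>(X :: nat set) (R :: nat set) (M :: nat list \<Rightarrow> nat pmf).
           randomized_algorithm n X R M \<and>
           perfectly_generalizing n X R \<beta> 0 0 M \<and>
           (\<forall>\<epsilon> \<delta> :: real. \<delta> < 1 \<longrightarrow> \<not> differentially_private n X R \<epsilon> \<delta> M)"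
proof -
  define s where "s = [0..<n]"
  define M :: "nat list \<Rightarrow> nat pmf" where "M = (\<lambda>T. return_pmf (if T = s then 1 else 0))"
  have \<beta>: "(1 / 2) ^ n \<le> \<beta>"
  proof -
    have "1 / \<beta> \<le> 2 powr real n"
      using assms by (simp add: log_le_iff)
    then show ?thesis
      using assms(1) by (simp add: powr_realpow field_simps)
  qed
  have "perfectly_generalizing n UNIV UNIV \<beta> 0 0 M"
    unfolding perfectly_generalizing_def
  proof (intro allI impI)
    fix C :: "nat pmf"
    let ?q = "pmf (replicate_pmf n C) s"
    let ?close = "\<lambda>Sim. {T. eps_delta_close 0 0 UNIV (M T) Sim}"
    show "\<exists>Sim. set_pmf Sim \<subseteq> UNIV \<and> 1 - \<beta> \<le> measure_pmf.prob (replicate_pmf n C) (?close Sim)"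
    proof (cases "?q \<le> \<beta>")
      case True
      have "1 - \<beta> \<le> measure_pmf.prob (replicate_pmf n C) (- {s})"
        using True measure_pmf.prob_compl[of "{s}" "replicate_pmf n C"]
        by (simp add: measure_pmf_single Compl_eq_Diff_UNIV)
      \<comment> \<open>Off \<open>s\<close> the output distribution is the simulator itself, so
        closeness is reflexivity.\<close>
      also have "\<dots> \<le> measure_pmf.prob (replicate_pmf n C) (?close (return_pmf 0))"
        by (intro measure_pmf.finite_measure_mono) (auto simp: M_def eps_delta_close_refl)
      finally show ?thesis
        by blast
    next
      case False
      have "n = 1"
      proof (rule ccontr)
        assume "n \<noteq> 1"
        have "?q \<le> (1 / real n) ^ n"
          using pmf_replicate_pmf_distinct_le[of s C] assms(2) by (simp add: s_def)
        also have "\<dots> \<le> (1 / 2) ^ n"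
          using \<open>n \<noteq> 1\<close> assms(2) by (intro power_mono) (auto simp: field_simps)
        finally show False
          using False \<beta> by simp
      qed
      \<comment> \<open>Now \<beta> is at least 1/2 and \<open>?q\<close> exceeds \<beta>, so
        \<open>?q\<close> > 1/2 \<ge> 1 - \<beta>.\<close>
      then have "1 - \<beta> \<le> measure_pmf.prob (replicate_pmf n C) {s}"
        using False \<beta> by (simp add: measure_pmf_single)
      also have "\<dots> \<le> measure_pmf.prob (replicate_pmf n C) (?close (return_pmf 1))"
        by (intro measure_pmf.finite_measure_mono) (auto simp: M_def eps_delta_close_refl)
      finally show ?thesis
        by blast
    qed
  qed
  moreover have "\<not> differentially_private n UNIV UNIV \<epsilon> \<delta> M" if "\<delta> < 1" for \<epsilon> \<delta> :: real
  proof
    assume dp: "differentially_private n UNIV UNIV \<epsilon> \<delta> M"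
    \<comment> \<open>The value \<open>n\<close> does not occur in \<open>s\<close>, so overwriting
      position 0, which exists since \<open>n \<ge> 1\<close>, changes exactly one entry.\<close>
    let ?t = "s[0 := n]"
    have diff: "{i. i < length s \<and> s ! i \<noteq> ?t ! i} = {0}"
      using assms(2) by (auto simp: s_def nth_list_update)
    have "?t ! 0 \<noteq> s ! 0"
      using assms(2) by (simp add: s_def)
    then have "?t \<noteq> s"
      by metis
    have "neighbouring s ?t"
      using diff by (simp add: neighbouring_def)
    then have "eps_delta_close \<epsilon> \<delta> UNIV (M s) (M ?t)"
      using dp by (simp add: differentially_private_def in_nlists_UNIV s_def)
    \<comment> \<open>The event \<open>{1}\<close> has probability 1 under \<open>M s\<close> and 0
      under \<open>M ?t\<close>; the factor \<open>exp \<epsilon>\<close> multiplies 0, leaving 1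
      \<le> \<delta>.\<close>
    then have "measure_pmf.prob (M s) {1} \<le> exp \<epsilon> * measure_pmf.prob (M ?t) {1} + \<delta>"
      by (simp add: eps_delta_close_def)
    then show False
      using \<open>?t \<noteq> s\<close> that by (simp add: M_def measure_pmf_single)
  qed
  ultimately show ?thesis
    by (intro exI[of _ UNIV] exI[of _ M]) (simp add: randomized_algorithm_def)
qed

end
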